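(* Let $n\ge 2$. Let $\mathcal{G}_n^{[0,2]}$ be the set of GDAP of length $n$ all of whose vertices have ordinate in $\{0,1,2\}$, and let $\mathcal{C}(n-2)$ be the set of compositions of $n-2$ (ordered sequences of positive integers summing to $n-2$) in which no two consecutive parts have the same parity. Define $\psi:\mathcal{G}_n^{[0,2]}\to\mathcal{C}(n-2)$ as follows. For $\alpha=\alpha_1\alpha_2\cdots\alpha_n\in\mathcal{G}_n^{[0,2]}$ (written as a word of steps), let $\alpha'=\alpha_2\alpha_3\cdots\alpha_{n-1}$. If $\alpha'$ contains neither the factor $UU$ nor the factor $UD_2$, set $r=1$ and $B_1=\alpha'$; otherwise, write $\alpha'=B_1B_2\cdots B_r$ by cutting $\alpha'$ immediately after each up-step of $\alpha'$ that is followed (in $\alpha'$) by another up-step or by a $D_2$-step. Let $b_i$ be the length of $B_i$ and set $\psi(\alpha)=(b_1,b_2,\dots,b_r)$ (when $\alpha'$ is empty, i.e. $\alpha=UD$, $\psi(\alpha)$ is the empty composition of $0$). Then $\psi$ is a bijection from $\mathcal{G}_n^{[0,2]}$ onto $\mathcal{C}(n-2)$.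
   Context: A grand Dyck path with air pockets (GDAP) is a lattice path in $\mathbb{Z}^2$ starting at $(0,0)$ and ending on the $x$-axis, consisting of up-steps $U=(1,1)$ and down-steps $D_k=(1,-k)$ with $k\ge 1$, such that no two down-steps are consecutive; the empty path is a GDAP. The length of a path is its number of steps; $D$ denotes $D_1$. *)

theory Defs
  imports Main "HOL-Library.Sublist"
begin

(* Every step advances the abscissa by one, so a path starting at (0,0) is given by its word of
   steps. Down k is the step (1,-k); the requirement k >= 1 is imposed in gdap. *)
datatype step = Up | Down nat

fun is_down :: "step \<Rightarrow> bool" where
  "is_down Up = False"
| "is_down (Down k) = True"

fun rise :: "step \<Rightarrow> int" where
  "rise Up = 1"
| "rise (Down k) = - int k"

definition ordinate :: "step list \<Rightarrow> nat \<Rightarrow> int" where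
  "ordinate w i = (\<Sum>s\<leftarrow>take i w. rise s)"

definition gdap :: "step list \<Rightarrow> bool" where
  "gdap w \<longleftrightarrow>
     (\<forall>k. Down k \<in> set w \<longrightarrow> k \<ge> 1) \<and>
     successively (\<lambda>s t. \<not> (is_down s \<and> is_down t)) w \<and>
     ordinate w (length w) = 0"

definition gdap_band :: "nat \<Rightarrow> step list set" where
  "gdap_band n = {w. gdap w \<and> length w = n \<and> (\<forall>i\<le>n. ordinate w i \<in> {0, 1, 2})}"

definition composition :: "nat \<Rightarrow> nat list \<Rightarrow> bool" where
  "composition m c \<longleftrightarrow> (\<forall>x\<in>set c. x > 0) \<and> sum_list c = m"

definition parity_compositions :: "nat \<Rightarrow> nat list set" where
  "parity_compositions m = {c. composition m c \<and> successively (\<lambda>a b. even a \<noteq> even b) c}"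

(* In the last equation, blocks (t # w) is nonempty and its first block starts with t;
   that block is extended by s unless a cut separates s from t. *)
fun blocks :: "step list \<Rightarrow> step list list" where
  "blocks [] = []"
| "blocks [s] = [[s]]"
| "blocks (s # t # w) =
     (if s = Up \<and> (t = Up \<or> t = Down 2)
      then [s] # blocks (t # w)
      else (s # hd (blocks (t # w))) # tl (blocks (t # w)))"

definition psi :: "step list \<Rightarrow> nat list" where
  "psi w =
     (let w' = butlast (tl w) in
      if w' = [] then []
      else if \<not> sublist [Up, Up] w' \<and> \<not> sublist [Up, Down 2] w' then [length w']
      else map length (blocks w'))"

end

theory Submission
  imports Defs
begin

text \<open>
  After the initial up-step the path stands at height \<open>1\<close>, and the prefixes ending with an up-step
  have height \<open>1\<close> or \<open>2\<close>. Between them the path can only read \<open>DU\<close> (at either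
  height, which it preserves), \<open>U\<close> (from \<open>1\<close> to \<open>2\<close>) or \<open>D\<^sub>2U\<close> (from \<open>2\<close> to \<open>1\<close>). The cuts
  are placed before the factors of the last two kinds, so a block is \<open>U(DU)\<^sup>k\<close>, of odd length and
  ending at height \<open>2\<close>, or \<open>D\<^sub>2U(DU)\<^sup>k\<close>, of even length and ending at height \<open>1\<close>; only the first
  block can also be \<open>(DU)\<^sup>k\<close>, which is even and ends at height \<open>1\<close> as well. Hence the parity of a
  block length gives the height at its end, consecutive blocks have opposite parities, and the
  path is recovered from the block lengths.
\<close>

fun zigzag :: "nat \<Rightarrow> step list" where
  "zigzag 0 = []"
| "zigzag (Suc k) = Down 1 # Up # zigzag k"

text \<open>
  The part of the path that follows a prefix ending with an up-step at height \<open>h\<close>, with blocks of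
  lengths \<open>c\<close>. The final down-step is included. The step \<open>Down h\<close> opening an even block is \<open>D\<close>
  when this block is the first one and \<open>D\<^sub>2\<close> otherwise.
\<close>

fun tail_path :: "nat \<Rightarrow> nat list \<Rightarrow> step list" where
  "tail_path h [] = [Down h]"
| "tail_path h (m # c) =
     (if odd m then Up # zigzag (m div 2) @ tail_path 2 c
      else Down h # Up # zigzag (m div 2 - 1) @ tail_path 1 c)"

definition air_path :: "int \<Rightarrow> step list \<Rightarrow> bool" where
  "air_path h w \<longleftrightarrow>
     (\<forall>k. Down k \<in> set w \<longrightarrow> k \<ge> 1) \<and>
     successively (\<lambda>s t. \<not> (is_down s \<and> is_down t)) w \<and>
     h + ordinate w (length w) = 0 \<and>
     (\<forall>i\<le>length w. h + ordinate w i \<in> {0, 1, 2})"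

lemma gdap_band_eq: "gdap_band n = {w. air_path 0 w \<and> length w = n}"
  by (auto simp: gdap_band_def gdap_def air_path_def)

lemma ordinate_0 [simp]: "ordinate w 0 = 0"
  by (simp add: ordinate_def)

lemma ordinate_Cons_Suc [simp]: "ordinate (s # w) (Suc i) = rise s + ordinate w i"
  by (simp add: ordinate_def)

lemma all_le_Suc: "(\<forall>i\<le>Suc n. P i) \<longleftrightarrow> P 0 \<and> (\<forall>i\<le>n. P (Suc i))"
  by (metis Suc_le_mono le0 not0_implies_Suc)

lemma air_path_Nil [simp]: "air_path h [] \<longleftrightarrow> h = 0"
  by (auto simp: air_path_def)

lemma air_path_Cons:
  "air_path h (s # w) \<longleftrightarrow>
     h \<in> {0, 1, 2} \<and> s \<noteq> Down 0 \<and> (w = [] \<or> \<not> (is_down s \<and> is_down (hd w))) \<and>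
     air_path (h + rise s) w"
proof -
  have "(\<forall>k. Down k \<in> set (s # w) \<longrightarrow> k \<ge> 1) \<longleftrightarrow> s \<noteq> Down 0 \<and> (\<forall>k. Down k \<in> set w \<longrightarrow> k \<ge> 1)"
    by (auto simp: Suc_le_eq)
  then show ?thesis
    unfolding air_path_def successively_Cons
    by (cases "w = []") (simp_all add: all_le_Suc add.assoc conj_ac del: list.set)
qed

lemma air_path_Up [simp]: "air_path h (Up # w) \<longleftrightarrow> h \<in> {0, 1, 2} \<and> air_path (h + 1) w"
  by (simp add: air_path_Cons)

lemma air_path_Down [simp]:
  "air_path h (Down k # w) \<longleftrightarrow>
     h \<in> {0, 1, 2} \<and> k > 0 \<and> (w = [] \<or> \<not> is_down (hd w)) \<and> air_path (h - int k) w"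
  by (simp add: air_path_Cons)

lemma air_path_start: "air_path h w \<Longrightarrow> h \<in> {0, 1, 2}"
  by (cases w) (auto simp: air_path_Cons)

lemma air_path_zigzag:
  "h \<in> {1, 2} \<Longrightarrow> air_path h w \<Longrightarrow> air_path h (zigzag k @ w)"
  by (induction k) auto

lemma tail_path_not_Nil [simp]: "tail_path h c \<noteq> []"
  by (cases c) auto

text \<open>An odd block opens with \<open>Up\<close>, which from height 2 would leave the
  band.\<close>

lemma air_path_tail_path:
  assumes "h \<in> {1, 2}" "h = 2 \<Longrightarrow> c = [] \<or> even (hd c)"
    and "successively (\<lambda>a b. even a \<noteq> even b) c"
  shows "air_path (int h) (tail_path h c)"
  using assms
proof (induction c arbitrary: h)
  case Nil
  then show ?case by auto
next
  case (Cons m c)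
  have "successively (\<lambda>a b. even a \<noteq> even b) c"
    and hd: "c = [] \<or> even (hd c) \<noteq> even m"
    using Cons.prems(3) by (cases c; auto)+
  then have "air_path 1 (tail_path 1 c)" "odd m \<Longrightarrow> air_path 2 (tail_path 2 c)"
    using Cons.IH[of 1] Cons.IH[of 2] by auto
  then show ?case
    using Cons.prems(1,2) by (auto intro!: air_path_zigzag)
qed

lemma length_zigzag [simp]: "length (zigzag k) = 2 * k"
  by (induction k) auto

lemma length_tail_path:
  "(\<forall>x\<in>set c. x > 0) \<Longrightarrow> length (tail_path h c) = Suc (sum_list c)"
  by (induction c arbitrary: h) (auto elim!: oddE evenE)

text \<open>The zigzag completes a block already begun. \<open>Suc h\<close> has the parity of a
  block ending at height \<open>h\<close> and stands for that block in the alternation.\<close>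

lemma air_path_imp_tail_path:
  assumes "air_path (int h) w" "h \<in> {1, 2}"
  shows "\<exists>k c. w = zigzag k @ tail_path h c \<and> (\<forall>x\<in>set c. x > 0) \<and>
           successively (\<lambda>a b. even a \<noteq> even b) (Suc h # c)"
  using assms
proof (induction w arbitrary: h rule: length_induct)
  case (1 w)
  let ?P = "\<lambda>h w. \<exists>k c. w = zigzag k @ tail_path h c \<and> (\<forall>x\<in>set c. x > 0) \<and>
           successively (\<lambda>a b. even a \<noteq> even b) (Suc h # c)"
  have IH: "?P g v" if "length v < length w" "air_path (int g) v" "g \<in> {1, 2}" for g v
    using "1.IH" that by blast
  consider v where "w = Up # v" "h = 1" "air_path (int 2) v"
    | "w = zigzag 0 @ tail_path h []"
    | v where "w = Down 1 # Up # v" "air_path (int h) v"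
    | v where "w = Down 2 # Up # v" "h = 2" "air_path (int 1) v"
  proof (cases w)
    case Nil
    then show ?thesis using "1.prems" by auto
  next
    case w: (Cons s v)
    show ?thesis
    proof (cases s)
      case Up
      with w "1.prems" that(1) show ?thesis
        by (auto dest: air_path_start)
    next
      case (Down k)
      show ?thesis
      proof (cases v)
        case Nil
        with w Down "1.prems" that(2) show ?thesis by auto
      next
        case v: (Cons t u)
        with w Down "1.prems" have "t = Up" by (cases t) auto
        with v w Down "1.prems" that(3,4) show ?thesis
          by (cases "k = 1"; cases "k = 2") auto
      qed
    qed
  qed
  then show ?case
  proof cases
    case (1 v)
    with IH[of v 2] obtain k c where "v = zigzag k @ tail_path 2 c" "\<forall>x\<in>set c. x > 0"
      "successively (\<lambda>a b. even a \<noteq> even b) (Suc 2 # c)"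
      by auto
    with 1 show ?thesis
      \<comment> \<open>\<open>Up\<close> and the zigzag after it merge into one odd block.\<close>
      by (intro exI[of _ 0] exI[of _ "(2 * k + 1) # c"]) (cases c; auto)
  next
    case 2
    then show ?thesis by (metis empty_iff list.set(1) successively.simps(2))
  next
    case (3 v)
    with IH[of v h] "1.prems" obtain k c where "v = zigzag k @ tail_path h c"
      "\<forall>x\<in>set c. x > 0" "successively (\<lambda>a b. even a \<noteq> even b) (Suc h # c)"
      by auto
    with 3 show ?thesis
      by (intro exI[of _ "Suc k"] exI[of _ c]) auto
  next
    case (4 v)
    with IH[of v 1] obtain k c where "v = zigzag k @ tail_path 1 c" "\<forall>x\<in>set c. x > 0"
      "successively (\<lambda>a b. even a \<noteq> even b) (Suc 1 # c)"
      by auto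
    with 4 show ?thesis
      by (intro exI[of _ 0] exI[of _ "(2 * k + 2) # c"]) (cases c; auto)
  qed
qed

text \<open>Each \<open>Up\<close> within the zigzag part is followed by \<open>Down 1\<close>, so
  the only possible cut is just before \<open>w\<close>.\<close>

lemma blocks_Up_zigzag:
  "w = [] \<or> hd w = Up \<or> hd w = Down 2 \<Longrightarrow>
    blocks (Up # zigzag k @ w) = (Up # zigzag k) # blocks w"
proof (induction k)
  case 0
  then show ?case by (cases w) auto
qed simp

lemma length_blocks_tail_path:
  assumes "\<forall>x\<in>set c. x > 0" "successively (\<lambda>a b. even a \<noteq> even b) c"
  shows "map length (blocks (butlast (tail_path h c))) = c"
  using assms
proof (induction c arbitrary: h)
  case (Cons m c)
  have c: "successively (\<lambda>a b. even a \<noteq> even b) c"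
    using Cons.prems(2) by (cases c) auto
  \<comment> \<open>The height at which the block of length \<open>m\<close> ends.\<close>
  define g :: nat where "g = (if odd m then 2 else 1)"
  let ?w = "butlast (tail_path g c)"
  have "?w = [] \<or> hd ?w = Up \<or> hd ?w = Down 2"
    using Cons.prems(2) by (cases c) (auto simp: g_def)
  note * = blocks_Up_zigzag[OF this]
  have "map length (blocks ?w) = c"
    using Cons.IH c Cons.prems(1) by auto
  with * Cons.prems(1) show ?case
    by (auto simp: g_def butlast_append elim!: evenE oddE)
qed auto

text \<open>Merges the uncut case of \<open>psi\<close> into the general one.\<close>

lemma blocks_eq_singleton:
  "w \<noteq> [] \<Longrightarrow> \<not> sublist [Up, Up] w \<Longrightarrow> \<not> sublist [Up, Down 2] w \<Longrightarrow> blocks w = [w]"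
  by (induction w rule: blocks.induct) (auto simp: sublist_Cons_right)

lemma psi_eq: "psi w = map length (blocks (butlast (tl w)))"
  by (simp add: psi_def Let_def blocks_eq_singleton)

theorem theorem5:
  fixes n :: nat
  assumes "n \<ge> 2"
  shows "bij_betw psi (gdap_band n) (parity_compositions (n - 2))"
proof -
  let ?f = "\<lambda>c. Up # tail_path 1 c"
  have "\<exists>c\<in>parity_compositions (n - 2). w = ?f c" if w: "w \<in> gdap_band n" for w
  proof -
    from w assms obtain v where v: "w = Up # v" "air_path 1 v" "length v = n - 1"
      by (cases w; cases "hd w") (auto simp: gdap_band_eq dest: air_path_start)
    from air_path_imp_tail_path[of 1 v] v obtain k c
      where kc: "v = zigzag k @ tail_path 1 c" "\<forall>x\<in>set c. x > 0"
        "successively (\<lambda>a b. even a \<noteq> even b) (2 # c)"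
      by (auto simp: numeral_2_eq_2)
    \<comment> \<open>No block precedes a nonempty initial zigzag, so it becomes an even first
      block; by the alternation of \<open>2 # c\<close>, an odd part follows, if any.\<close>
    define d where "d = (if k = 0 then c else 2 * k # c)"
    have d: "v = tail_path 1 d" "\<forall>x\<in>set d. x > 0" "successively (\<lambda>a b. even a \<noteq> even b) d"
      using kc by (cases k; cases c; auto simp: d_def)+
    with v length_tail_path[of d 1] show ?thesis
      by (auto simp: parity_compositions_def composition_def)
  qed
  moreover have "?f c \<in> gdap_band n" "psi (?f c) = c" if "c \<in> parity_compositions (n - 2)" for c
    using that assms air_path_tail_path[of 1 c]
    by (auto simp: gdap_band_eq psi_eq length_tail_path length_blocks_tail_path
        parity_compositions_def composition_def)
  ultimately show ?thesis
    by (intro bij_betw_byWitness[where f' = ?f]) force+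
qed

end
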